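(* Let $\mathcal{L}, \mathcal{T}, \mathcal{S} \subset \mathbb{R}^2$ be, respectively, a line segment of length $1$, an equilateral triangle of side length $\frac12$, and a square of side length $\frac13$, placed arbitrarily in the Euclidean plane. Then the convex hull of $\mathcal{L} \cup \mathcal{T} \cup \mathcal{S}$ has area at least $0.227498$.
   Context: "Placed arbitrarily" means that the three objects may have any positions and orientations in the plane, independently of each other (they may overlap). Triangles and squares are understood as filled regions. *)

theory Defs
  imports "HOL-Analysis.Analysis"
begin

definition segment_of_length :: "real \<Rightarrow> (real^2) set \<Rightarrow> bool" where
  "segment_of_length l L \<longleftrightarrow> (\<exists>a b. dist a b = l \<and> L = closed_segment a b)"

definition equilateral_triangle :: "real \<Rightarrow> (real^2) set \<Rightarrow> bool" where
  "equilateral_triangle l T \<longleftrightarrow>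
     (\<exists>a b c. dist a b = l \<and> dist b c = l \<and> dist c a = l \<and> T = convex hull {a, b, c})"

text \<open>The vertices \<open>a, b, c, d\<close> are listed in cyclic order. The parallelogram condition
  \<open>c - d = b - a\<close> excludes the degenerate configuration \<open>c = a\<close>, which has four equal sides
  and a right angle at \<open>a\<close>.\<close>

definition square :: "real \<Rightarrow> (real^2) set \<Rightarrow> bool" where
  "square l S \<longleftrightarrow>
     (\<exists>a b c d. c - d = b - a \<and> orthogonal (b - a) (d - a) \<and> dist a b = l \<and> dist a d = l \<and>
        S = convex hull {a, b, c, d})"

end

theory Submission
  imports Defs
begin

text \<open>Let \<open>K\<close> be the convex hull, \<open>m\<close> twice its area, \<open>l\<close> the unit direction of the segment and
  \<open>H = 2 * 0.227498\<close>. The proof rests on two lower bounds for \<open>m\<close>.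

  \<^item> If \<open>K\<close> contains the segments \<open>AB\<close> and \<open>QP\<close>, then \<open>m\<close> is at least the absolute value of the cross
    product of \<open>B - A\<close> and \<open>P - Q\<close> (\<open>crossing_segments_le_area\<close>). Taking the unit segment for \<open>AB\<close>, \<open>m\<close> is
    at least the width of \<open>K\<close> perpendicular to \<open>l\<close>.
  \<^item> If \<open>K\<close> contains a square of side \<open>r\<close> with unit axes \<open>e\<close> and \<open>f\<close>, then \<open>m\<close> is at least \<open>r\<close> times the
    sum of the widths of \<open>K\<close> along \<open>e\<close> and \<open>f\<close>: the farthest points of \<open>K\<close> in the four directions span
    triangles over the four sides of the square (\<open>square_widths_le_area\<close>).

  Suppose \<open>m < H\<close>. Place \<open>l\<close> horizontally, with the triangle standing on its flattest side, and let
  the axes of the square be \<open>e = (c, s)\<close> and \<open>f = (- s, c)\<close> with \<open>0 \<le> s \<le> c\<close>. By the first bound the square has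
  height \<open>(c + s) / 3 \<le> H\<close>, so it is tilted by less than 30 degrees, and the two steep sides of the triangle
  have heights \<open>q, q' \<le> H\<close>, so its flat side makes an angle of at most about 5.5 degrees with \<open>l\<close>. The
  segment has width \<open>c\<close> along \<open>e\<close>. A steep side \<open>(- p, q)\<close> of the triangle has width \<open>c * q + s * p\<close> along \<open>f\<close>.
  The second bound therefore gives \<open>c * (1 + q) + s * p \<le> 3 * H\<close>. Together these inequalities are
  almost contradictory: they leave only a tiny corner of the angles, \<open>q \<le> 0.4085\<close> and \<open>s \<ge> 0.497\<close>
  (\<open>tilt_bounds\<close>).

  In the corner the triangle and the square both reach almost from the bottom to the top of \<open>K\<close>
  (\<open>corner_impossible\<close>). If the upper foot of the triangle lies noticeably above the line of the segment, then
  measuring one of the two widths from this foot instead of an end of the segment improves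
  the second bound enough. If not, the other foot lies at depth at least 0.044. From bottom to top, the long
  steep side of the triangle moves by more than 0.207 horizontally and the diagonal of the square by less
  than 0.124. Hence their top vertices or their bottom vertices are at least 0.04 apart. The boundary
  of \<open>K\<close> then has a nearly flat piece above or below the segment, and a fan of three
  triangles (\<open>fan_le_area\<close>) has too large an area.\<close>

section \<open>Separated convex hulls\<close>

definition separated :: "(real^2) set \<Rightarrow> (real^2) set \<Rightarrow> bool" where
  "separated V W \<longleftrightarrow> (\<exists>w \<gamma>. w \<noteq> 0 \<and> (\<forall>x\<in>V. w \<bullet> x \<le> \<gamma>) \<and> (\<forall>x\<in>W. \<gamma> \<le> w \<bullet> x))"

lemma separated_sym: "separated V W \<Longrightarrow> separated W V"
proof -
  assume "separated V W"
  then obtain w \<gamma> where w: "w \<noteq> 0" "\<forall>x\<in>V. w \<bullet> x \<le> \<gamma>" "\<forall>x\<in>W. \<gamma> \<le> w \<bullet> x"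
    unfolding separated_def by blast
  then show ?thesis
    unfolding separated_def by (intro exI[of _ "-w"] exI[of _ "-\<gamma>"]) auto
qed

lemma separatedI:
  assumes "w \<noteq> 0" "\<And>x. x \<in> V \<Longrightarrow> w \<bullet> (x - z) \<le> \<gamma>" "\<And>x. x \<in> W \<Longrightarrow> \<gamma> \<le> w \<bullet> (x - z)"
  shows "separated V W"
  unfolding separated_def using assms
  by (intro exI[of _ w] exI[of _ "\<gamma> + w \<bullet> z"]) (auto simp: inner_diff_right algebra_simps)

lemma negligible_Int_separated_hulls:
  assumes "separated V W"
  shows "negligible (convex hull V \<inter> convex hull W)"
proof -
  obtain w \<gamma> where w: "w \<noteq> 0" and V: "V \<subseteq> {x. w \<bullet> x \<le> \<gamma>}" and W: "W \<subseteq> {x. w \<bullet> x \<ge> \<gamma>}"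
    using assms unfolding separated_def by blast
  have "convex hull V \<subseteq> {x. w \<bullet> x \<le> \<gamma>}" "convex hull W \<subseteq> {x. w \<bullet> x \<ge> \<gamma>}"
    by (intro hull_minimal V W convex_halfspace_le convex_halfspace_ge)+
  then have "convex hull V \<inter> convex hull W \<subseteq> {x. w \<bullet> x = \<gamma>}"
    by fastforce
  then show ?thesis
    using negligible_hyperplane[of w \<gamma>] w negligible_subset by blast
qed

text \<open>Convex hulls that are separated by lines overlap only in null sets, so their areas add up. All area
  estimates below apply this to lists of triangles with vertices in \<open>K\<close>.\<close>

lemma sum_measure_separated_hulls_le:
  assumes "sorted_wrt separated Vs" "\<forall>V\<in>set Vs. finite V \<and> V \<subseteq> K"
    and K: "convex K" "K \<in> lmeasurable"
  shows "(\<Sum>V\<leftarrow>Vs. measure lebesgue (convex hull V)) \<le> measure lebesgue K"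
proof -
  have "(\<Union>V\<in>set Vs. convex hull V) \<in> lmeasurable
      \<and> measure lebesgue (\<Union>V\<in>set Vs. convex hull V) = (\<Sum>V\<leftarrow>Vs. measure lebesgue (convex hull V))"
    using assms(1,2)
  proof (induction Vs)
    case (Cons V Vs)
    let ?U = "\<Union>V\<in>set Vs. convex hull V"
    have IH: "?U \<in> lmeasurable" "measure lebesgue ?U = (\<Sum>V\<leftarrow>Vs. measure lebesgue (convex hull V))"
      using Cons by auto
    have V: "convex hull V \<in> lmeasurable"
      using Cons.prems(2) by (simp add: finite_imp_compact_convex_hull lmeasurable_compact)
    have "negligible (\<Union>W\<in>set Vs. convex hull V \<inter> convex hull W)"
      using Cons.prems(1) by (intro negligible_Union) (auto intro: negligible_Int_separated_hulls)
    then have "measure lebesgue (convex hull V \<inter> ?U) = 0"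
      by (simp add: negligible_imp_measure0)
    then show ?case
      using IH V by (simp add: fmeasurable.Un measure_Un3)
  qed simp
  moreover have "(\<Union>V\<in>set Vs. convex hull V) \<subseteq> K"
    using assms(2) K(1) by (auto dest: hull_minimal[of _ K convex])
  ultimately show ?thesis
    using K(2) by (metis fmeasurableD measure_mono_fmeasurable)
qed

section \<open>Orthonormal frames and triangles\<close>

definition orthonormal :: "real^2 \<Rightarrow> real^2 \<Rightarrow> bool" where
  "orthonormal e f \<longleftrightarrow> e \<bullet> e = 1 \<and> f \<bullet> f = 1 \<and> e \<bullet> f = 0"

lemma inner2: "x \<bullet> y = x$1 * y$1 + x$2 * y$2" for x y :: "real^2"
  by (simp add: inner_vec_def sum_2)

lemma inner_diff_self_eq_dist:
  "dist x y = d \<Longrightarrow> (x - y) \<bullet> (x - y) = d\<^sup>2" for x y :: "real^2"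
  by (simp add: dist_norm dot_square_norm)

lemma orthonormal_minus:
  assumes "orthonormal e f"
  shows "orthonormal (-e) f" "orthonormal e (-f)" "orthonormal f e"
  using assms by (auto simp: orthonormal_def inner_commute)

lemma orthonormal_cases:
  assumes "orthonormal e f"
  obtains "f = vector [- e$2, e$1]" | "f = vector [e$2, - e$1]"
proof -
  have e: "e$1 * e$1 + e$2 * e$2 = 1" "f$1 * f$1 + f$2 * f$2 = 1" "e$1 * f$1 + e$2 * f$2 = 0"
    using assms by (auto simp: orthonormal_def inner2)
  define t where "t = e$1 * f$2 - e$2 * f$1"
  have f: "f$1 = - t * e$2" "f$2 = t * e$1"
    unfolding t_def using e(1,3) by algebra+
  have "t\<^sup>2 = 1"
    using e f by algebra
  then consider "t = 1" | "t = -1"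
    by (auto simp: power2_eq_1_iff)
  then show thesis
    using that f by cases (auto simp: vec_eq_iff forall_2)
qed

lemma orthonormal_inner:
  assumes "orthonormal e f"
  shows "u \<bullet> v = (u \<bullet> e) * (v \<bullet> e) + (u \<bullet> f) * (v \<bullet> f)"
proof -
  have e: "e$1 * e$1 + e$2 * e$2 = 1"
    using assms by (auto simp: orthonormal_def inner2)
  have "(u \<bullet> e) * (v \<bullet> e) + (u \<bullet> f) * (v \<bullet> f) = (u \<bullet> v) * (e$1 * e$1 + e$2 * e$2)"
    using orthonormal_cases[OF assms] by cases (simp_all add: inner2 algebra_simps)
  then show ?thesis using e by simp
qed

text \<open>The determinant of the coordinates of \<open>u\<close> and \<open>v\<close> in the frame \<open>e, f\<close>. It changes sign with the orientation
  of the frame; no orientation is fixed, so that configurations can be reflected by reversing an axis.\<close>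

definition cross :: "real^2 \<Rightarrow> real^2 \<Rightarrow> real^2 \<Rightarrow> real^2 \<Rightarrow> real" where
  "cross e f u v = (u \<bullet> e) * (v \<bullet> f) - (u \<bullet> f) * (v \<bullet> e)"

lemma measure_triangle:
  assumes "orthonormal e f"
  shows "2 * measure lebesgue (convex hull {A, B, C}) = \<bar>cross e f (B - A) (C - A)\<bar>"
proof -
  have e: "e$1 * e$1 + e$2 * e$2 = 1"
    using assms by (auto simp: orthonormal_def inner2)
  let ?d = "(C$1 - A$1) * (B$2 - A$2) - (B$1 - A$1) * (C$2 - A$2)"
  have "measure lebesgue (convex hull {A, B, C}) = measure lborel (convex hull {A, B, C})"
    by (intro measure_completion)
      (simp add: finite_imp_compact_convex_hull compact_imp_closed borel_closed)
  then have "2 * measure lebesgue (convex hull {A, B, C}) = \<bar>?d\<bar>"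
    using content_triangle[of A B C] by simp
  moreover have "cross e f (B - A) (C - A) = - ?d \<or> cross e f (B - A) (C - A) = ?d"
    using orthonormal_cases[OF assms]
  proof cases
    case 1
    then have "cross e f (B - A) (C - A) = - ?d * (e$1 * e$1 + e$2 * e$2)"
      by (simp add: cross_def inner2 algebra_simps)
    then show ?thesis using e by simp
  next
    case 2
    then have "cross e f (B - A) (C - A) = ?d * (e$1 * e$1 + e$2 * e$2)"
      by (simp add: cross_def inner2 algebra_simps)
    then show ?thesis using e by simp
  qed
  ultimately show ?thesis by auto
qed

lemma triangle_area_le:
  assumes "orthonormal e f" "convex K" "K \<in> lmeasurable" "A \<in> K" "B \<in> K" "C \<in> K"
  shows "\<bar>cross e f (B - A) (C - A)\<bar> \<le> 2 * measure lebesgue K"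
  using sum_measure_separated_hulls_le[of "[{A, B, C}]" K] measure_triangle[OF assms(1), of A B C] assms
  by auto

text \<open>The separating line passes through \<open>z\<close> in direction \<open>u\<close>. The vector \<open>v\<close> only certifies that \<open>u \<noteq> 0\<close>.\<close>

lemma separated_by_line:
  assumes "cross e f u v \<noteq> 0"
    and "\<And>x. x \<in> V \<Longrightarrow> cross e f u (x - z) \<le> 0" "\<And>x. x \<in> W \<Longrightarrow> 0 \<le> cross e f u (x - z)"
  shows "separated V W"
proof -
  let ?w = "(u \<bullet> e) *\<^sub>R f - (u \<bullet> f) *\<^sub>R e"
  have w: "?w \<bullet> v = cross e f u v" for v
    by (simp add: cross_def inner_diff_left inner_diff_right inner_commute)
  then have "?w \<noteq> 0"
    using assms(1) by (metis inner_zero_left)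
  then show ?thesis
    using assms(2,3) by (intro separatedI[of ?w _ z 0]) (simp_all only: w not_False_eq_True)
qed

text \<open>If \<open>P\<close> and \<open>Q\<close> lie on different sides of the line \<open>AB\<close>, the triangles \<open>ABP\<close> and \<open>ABQ\<close> are separated and their
  areas add up. If not, the larger of the two triangles is already enough.\<close>

lemma crossing_segments_le_area:
  assumes ef: "orthonormal e f" and K: "convex K" "K \<in> lmeasurable"
    and mem: "A \<in> K" "B \<in> K" "P \<in> K" "Q \<in> K"
  shows "cross e f (B - A) (P - Q) \<le> 2 * measure lebesgue K"
proof -
  let ?g = "\<lambda>Z. cross e f (B - A) (Z - A)"
  have diff: "cross e f (B - A) (P - Q) = ?g P - ?g Q"
    by (simp add: cross_def inner_diff_left algebra_simps)
  have gP: "\<bar>?g P\<bar> \<le> 2 * measure lebesgue K" and gQ: "\<bar>?g Q\<bar> \<le> 2 * measure lebesgue K"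
    using triangle_area_le[OF ef K mem(1,2)] mem by auto
  show ?thesis
  proof (cases "?g P > 0 \<and> ?g Q < 0")
    case True
    have "separated {A, B, Q} {A, B, P}"
      using True by (intro separated_by_line[of e f "B - A" "P - A" _ A]) (auto simp: cross_def)
    then have "measure lebesgue (convex hull {A, B, Q}) + measure lebesgue (convex hull {A, B, P})
        \<le> measure lebesgue K"
      using sum_measure_separated_hulls_le[of "[{A, B, Q}, {A, B, P}]" K] K mem by simp
    then show ?thesis
      using measure_triangle[OF ef, of A B Q] measure_triangle[OF ef, of A B P] True diff by linarith
  next
    case False
    then show ?thesis
      using diff gP gQ by linarith
  qed
qed

text \<open>The triangles \<open>zC(z + e)\<close>, \<open>z(z + e)A\<close> and \<open>zAB\<close> are separated by lines through \<open>z\<close> if \<open>B\<close> comes after \<open>A\<close>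
  in the sense of rotation from \<open>e\<close> to \<open>f\<close>. In the other case the cross product is not positive, and
  the first two triangles suffice.\<close>

lemma fan_le_area:
  assumes ef: "orthonormal e f" and K: "convex K" "K \<in> lmeasurable"
    and mem: "z \<in> K" "z + e \<in> K" "A \<in> K" "B \<in> K" "C \<in> K"
    and up: "(A - z) \<bullet> f \<ge> 0" "(B - z) \<bullet> f \<ge> 0" and down: "(C - z) \<bullet> f \<le> 0"
  shows "(A - z) \<bullet> f + cross e f (A - z) (B - z) - (C - z) \<bullet> f \<le> 2 * measure lebesgue K"
proof -
  note onb = ef[unfolded orthonormal_def] ef[THEN orthonormal_minus(3), unfolded orthonormal_def]
  have e: "cross e f e v = v \<bullet> f" for v
    using onb by (simp add: cross_def)
  have t1: "2 * measure lebesgue (convex hull {z, z + e, A}) = (A - z) \<bullet> f"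
    using measure_triangle[OF ef, of z "z + e" A] up by (simp add: e)
  have t2: "2 * measure lebesgue (convex hull {z, A, B}) = \<bar>cross e f (A - z) (B - z)\<bar>"
    using measure_triangle[OF ef, of z A B] .
  have t3: "2 * measure lebesgue (convex hull {z, z + e, C}) = - ((C - z) \<bullet> f)"
    using measure_triangle[OF ef, of z "z + e" C] down by (simp add: e)
  have s13: "separated {z, z + e, C} {z, z + e, A}" and s23: "separated {z, z + e, C} {z, A, B}"
    using onb up down
    by (auto intro!: separated_by_line[of e f e f _ z] simp: e)
  show ?thesis
  proof (cases "cross e f (A - z) (B - z) > 0")
    case True
    have "separated {z, z + e, A} {z, A, B}"
      using True up onb
      by (intro separated_by_line[of e f "A - z" "B - z" _ z]) (auto simp: cross_def)
    then have "measure lebesgue (convex hull {z, z + e, C}) + (measure lebesgue (convex hull {z, z + e, A})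
        + measure lebesgue (convex hull {z, A, B})) \<le> measure lebesgue K"
      using sum_measure_separated_hulls_le[of "[{z, z + e, C}, {z, z + e, A}, {z, A, B}]" K] K mem s13 s23
      by simp
    then show ?thesis
      using t1 t2 t3 True by linarith
  next
    case False
    have "measure lebesgue (convex hull {z, z + e, C}) + measure lebesgue (convex hull {z, z + e, A})
       \<le> measure lebesgue K"
      using sum_measure_separated_hulls_le[of "[{z, z + e, C}, {z, z + e, A}]" K] K mem s13 by simp
    then show ?thesis
      using t1 t3 False by linarith
  qed
qed

section \<open>A square inside a convex set\<close>

definition square_in :: "(real^2) set \<Rightarrow> real \<Rightarrow> real^2 \<Rightarrow> real^2 \<Rightarrow> real^2 \<Rightarrow> bool" where
  "square_in K r w e f \<longleftrightarrow> orthonormal e f \<and>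
     {w, w + r *\<^sub>R e, w + r *\<^sub>R f, w + r *\<^sub>R e + r *\<^sub>R f} \<subseteq> K"

text \<open>At the corner \<open>k\<close> of the square, \<open>P\<close> is the extremal point in direction \<open>e\<close> and \<open>Q\<close> the extremal point in direction
  \<open>f\<close>. Both triangles may reach into the quadrant beyond \<open>k\<close>, but there \<open>Q\<close> lies on the far side of the
  line \<open>kP\<close>, because \<open>P\<close> is at least as far out along \<open>e\<close> and \<open>Q\<close> at least as far out along \<open>f\<close>.\<close>

lemma separated_at_corner:
  assumes ef: "orthonormal e f" and "r \<ge> 0"
    and P: "(P - k) \<bullet> e \<ge> 0" and Q: "(Q - k) \<bullet> f \<ge> 0"
    and PQ: "(Q - k) \<bullet> e \<le> (P - k) \<bullet> e" "(P - k) \<bullet> f \<le> (Q - k) \<bullet> f"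
  shows "separated {k - r *\<^sub>R f, k, P} {k - r *\<^sub>R e, k, Q}"
proof -
  note onb = ef[unfolded orthonormal_def] ef[THEN orthonormal_minus(3), unfolded orthonormal_def]
  show ?thesis
  proof (cases "(P - k) \<bullet> f \<le> 0")
    case True
    have "f \<noteq> 0" using onb by auto
    then show ?thesis
      using True Q \<open>r \<ge> 0\<close> onb
      by (intro separatedI[of f _ k 0]) (auto simp: inner_commute)
  next
    case False
    have "(P - k) \<bullet> f * ((Q - k) \<bullet> e) \<le> (P - k) \<bullet> f * ((P - k) \<bullet> e)"
      using False PQ by (intro mult_left_mono) auto
    also have "\<dots> \<le> (Q - k) \<bullet> f * ((P - k) \<bullet> e)"
      using P PQ by (intro mult_right_mono) auto
    finally have "cross e f (P - k) (Q - k) \<ge> 0"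
      by (simp add: cross_def mult.commute)
    then show ?thesis
      using False P \<open>r \<ge> 0\<close> onb
      by (intro separated_by_line[of e f "P - k" e _ k]) (auto simp: cross_def)
  qed
qed

text \<open>The square is cut into two triangles, and a triangle is put on each of its sides, with apex at the
  extremal point in that direction. A triangle on a side of length \<open>r\<close> whose apex is at distance \<open>h\<close> from
  the line of that side has doubled area \<open>r * h\<close>, and the square itself contributes \<open>2 * r * r\<close>.\<close>

lemma square_widths_le_area_extremal:
  assumes sq: "square_in K r w e f" and r: "r > 0" and K: "convex K" "K \<in> lmeasurable"
    and mem: "P \<in> K" "Q \<in> K" "P' \<in> K" "Q' \<in> K"
    and e_ext: "\<And>Z. Z \<in> {w, w + r *\<^sub>R e, P', Q'} \<Longrightarrow> Z \<bullet> e \<le> P \<bullet> e \<and> Q \<bullet> e \<le> Z \<bullet> e"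
    and f_ext: "\<And>Z. Z \<in> {w, w + r *\<^sub>R f, P, Q} \<Longrightarrow> Z \<bullet> f \<le> P' \<bullet> f \<and> Q' \<bullet> f \<le> Z \<bullet> f"
  shows "r * ((P - Q) \<bullet> e + (P' - Q') \<bullet> f) \<le> 2 * measure lebesgue K"
proof -
  have ef: "orthonormal e f" and sqK: "w \<in> K" "w + r *\<^sub>R e \<in> K" "w + r *\<^sub>R f \<in> K" "w + r *\<^sub>R e + r *\<^sub>R f \<in> K"
    using sq by (auto simp: square_in_def)
  note onb = ef[unfolded orthonormal_def] ef[THEN orthonormal_minus(3), unfolded orthonormal_def]
  define N1 N2 k where "N1 = w + r *\<^sub>R e" and "N2 = w + r *\<^sub>R f" and "k = w + r *\<^sub>R e + r *\<^sub>R f"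
  note N = N1_def N2_def k_def
  have ext: "w \<bullet> e + r \<le> P \<bullet> e" "Q \<bullet> e \<le> w \<bullet> e" "w \<bullet> f + r \<le> P' \<bullet> f" "Q' \<bullet> f \<le> w \<bullet> f"
    using e_ext[of "w + r *\<^sub>R e"] e_ext[of w] f_ext[of "w + r *\<^sub>R f"] f_ext[of w] onb
    by (simp_all add: inner_add_left)
  have ext': "P' \<bullet> e \<le> P \<bullet> e" "Q' \<bullet> e \<le> P \<bullet> e" "Q \<bullet> e \<le> P' \<bullet> e" "Q \<bullet> e \<le> Q' \<bullet> e"
    "P \<bullet> f \<le> P' \<bullet> f" "Q \<bullet> f \<le> P' \<bullet> f" "Q' \<bullet> f \<le> P \<bullet> f" "Q' \<bullet> f \<le> Q \<bullet> f"
    using e_ext[of P'] e_ext[of Q'] f_ext[of P] f_ext[of Q] by simp_all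
  define X Y where "X Z = (Z - w) \<bullet> e" and "Y Z = (Z - w) \<bullet> f" for Z
  have XY: "X w = 0" "X N1 = r" "X N2 = 0" "X k = r" "Y w = 0" "Y N1 = 0" "Y N2 = r" "Y k = r"
      "X P \<ge> r" "X Q \<le> 0" "Y P' \<ge> r" "Y Q' \<le> 0"
    using onb ext by (auto simp: X_def Y_def N inner_add_left inner_diff_left)
  have c: "cross e f (B - A) (C - A) = (X B - X A) * (Y C - Y A) - (Y B - Y A) * (X C - X A)" for A B C
    by (simp add: cross_def X_def Y_def inner_diff_left)
  note tri = measure_triangle[OF ef, unfolded c]
  have areas: "2 * measure lebesgue (convex hull {w, N1, N2}) = r * r"
    "2 * measure lebesgue (convex hull {N1, N2, k}) = r * r"
    "2 * measure lebesgue (convex hull {N1, k, P}) = r * (X P - r)"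
    "2 * measure lebesgue (convex hull {N2, k, P'}) = r * (Y P' - r)"
    "2 * measure lebesgue (convex hull {w, N2, Q}) = - r * X Q"
    "2 * measure lebesgue (convex hull {w, N1, Q'}) = - r * Y Q'"
    using r XY by (auto simp: tri abs_mult)
  have e0: "e \<noteq> 0" "f \<noteq> 0" using onb by auto
  have sepe: "separated V W" if "\<And>Z. Z \<in> V \<Longrightarrow> X Z \<le> \<gamma>" "\<And>Z. Z \<in> W \<Longrightarrow> X Z \<ge> \<gamma>" for V W \<gamma>
    using that e0 by (intro separatedI[of e _ w \<gamma>]) (auto simp: X_def inner_commute)
  have sepf: "separated V W" if "\<And>Z. Z \<in> V \<Longrightarrow> Y Z \<le> \<gamma>" "\<And>Z. Z \<in> W \<Longrightarrow> Y Z \<ge> \<gamma>" for V W \<gamma>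
    using that e0 by (intro separatedI[of f _ w \<gamma>]) (auto simp: Y_def inner_commute)
  have diag: "separated {w, N1, N2} {N1, N2, k}"
    using r XY(1-8)
    by (intro separated_sym[OF separated_by_line[of e f "N2 - N1" "w - N1" _ N1]]) (auto simp: c)
  have corners: "separated {N1, k, P} {N2, k, P'}" "separated {N1, k, P} {w, N1, Q'}"
    "separated {w, N2, Q} {N2, k, P'}" "separated {w, N2, Q} {w, N1, Q'}"
  proof -
    have "separated {k - r *\<^sub>R f, k, P} {k - r *\<^sub>R e, k, P'}"
      using ef r ext ext' onb
      by (intro separated_at_corner) (auto simp: N inner_diff_left inner_add_left)
    then show "separated {N1, k, P} {N2, k, P'}" by (simp add: N)
    have "separated {N1 - r *\<^sub>R (- f), N1, P} {N1 - r *\<^sub>R e, N1, Q'}"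
      using ef r ext ext' onb
      by (intro separated_at_corner orthonormal_minus(1,2)) (auto simp: N inner_diff_left inner_add_left)
    then show "separated {N1, k, P} {w, N1, Q'}" by (simp add: N insert_commute)
    have "separated {N2 - r *\<^sub>R f, N2, Q} {N2 - r *\<^sub>R (- e), N2, P'}"
      using ef r ext ext' onb
      by (intro separated_at_corner orthonormal_minus(1,2)) (auto simp: N inner_diff_left inner_add_left)
    then show "separated {w, N2, Q} {N2, k, P'}" by (simp add: N insert_commute algebra_simps)
    have "separated {w - r *\<^sub>R (- f), w, Q} {w - r *\<^sub>R (- e), w, Q'}"
      using ef r ext ext' onb
      by (intro separated_at_corner orthonormal_minus(1,2)) (auto simp: N inner_diff_left inner_add_left)
    then show "separated {w, N2, Q} {w, N1, Q'}" by (simp add: N insert_commute)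
  qed
  let ?Vs = "[{w, N1, N2}, {N1, N2, k}, {N1, k, P}, {w, N2, Q}, {N2, k, P'}, {w, N1, Q'}]"
  have right: "separated {w, N1, N2} {N1, k, P}" "separated {N1, N2, k} {N1, k, P}"
    "separated {w, N2, Q} {N1, k, P}"
    using r XY by (auto intro!: sepe[of _ r])
  have left: "separated {w, N2, Q} {w, N1, N2}" "separated {w, N2, Q} {N1, N2, k}"
    using r XY by (auto intro!: sepe[of _ 0])
  have top: "separated {w, N1, N2} {N2, k, P'}" "separated {N1, N2, k} {N2, k, P'}"
    "separated {w, N1, Q'} {N2, k, P'}"
    using r XY by (auto intro!: sepf[of _ r])
  have bottom: "separated {w, N1, Q'} {w, N1, N2}" "separated {w, N1, Q'} {N1, N2, k}"
    using r XY by (auto intro!: sepf[of _ 0])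
  have "sorted_wrt separated ?Vs"
    using diag corners right left[THEN separated_sym] top bottom[THEN separated_sym]
      right(3)[THEN separated_sym] top(3)[THEN separated_sym]
    by simp
  then have "(\<Sum>V\<leftarrow>?Vs. measure lebesgue (convex hull V)) \<le> measure lebesgue K"
    using mem sqK by (intro sum_measure_separated_hulls_le K) (auto simp: N)
  then have "r * r + r * r + r * (X P - r) - r * X Q + r * (Y P' - r) - r * Y Q' \<le> 2 * measure lebesgue K"
    using areas by simp
  then show ?thesis
    by (simp add: X_def Y_def inner_diff_left algebra_simps)
qed

text \<open>Both widths only grow when the four points are replaced by extremal ones.\<close>

lemma square_widths_le_area:
  assumes sq: "square_in K r w e f" and r: "r > 0" and K: "convex K" "K \<in> lmeasurable"
    and mem: "P \<in> K" "Q \<in> K" "P' \<in> K" "Q' \<in> K"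
  shows "r * ((P - Q) \<bullet> e + (P' - Q') \<bullet> f) \<le> 2 * measure lebesgue K"
proof -
  define V where "V = {w, w + r *\<^sub>R e, w + r *\<^sub>R f, P, Q, P', Q'}"
  have V: "finite V" "V \<noteq> {}" "V \<subseteq> K" "{P, Q, P', Q', w, w + r *\<^sub>R e, w + r *\<^sub>R f} \<subseteq> V"
    using sq mem by (auto simp: V_def square_in_def)
  have max_ex: "\<exists>Z\<in>V. \<forall>Z'\<in>V. h Z' \<le> h Z" for h :: "real^2 \<Rightarrow> real"
  proof -
    have "Max (h ` V) \<in> h ` V"
      using V(1,2) by (intro Max_in) auto
    then obtain Z where "Z \<in> V" "h Z = Max (h ` V)" by auto
    then show ?thesis
      using V(1) by (metis Max_ge finite_imageI imageI)
  qed
  obtain P0 where P0: "P0 \<in> V" "\<And>Z. Z \<in> V \<Longrightarrow> Z \<bullet> e \<le> P0 \<bullet> e"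
    using max_ex[of "\<lambda>Z. Z \<bullet> e"] by blast
  obtain Q0 where Q0: "Q0 \<in> V" "\<And>Z. Z \<in> V \<Longrightarrow> Q0 \<bullet> e \<le> Z \<bullet> e"
    using max_ex[of "\<lambda>Z. - (Z \<bullet> e)"] by auto
  obtain P1 where P1: "P1 \<in> V" "\<And>Z. Z \<in> V \<Longrightarrow> Z \<bullet> f \<le> P1 \<bullet> f"
    using max_ex[of "\<lambda>Z. Z \<bullet> f"] by blast
  obtain Q1 where Q1: "Q1 \<in> V" "\<And>Z. Z \<in> V \<Longrightarrow> Q1 \<bullet> f \<le> Z \<bullet> f"
    using max_ex[of "\<lambda>Z. - (Z \<bullet> f)"] by auto
  note VV = P0(1) Q0(1) P1(1) Q1(1) and max = P0(2) Q0(2) P1(2) Q1(2)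
  have "(P - Q) \<bullet> e + (P' - Q') \<bullet> f \<le> (P0 - Q0) \<bullet> e + (P1 - Q1) \<bullet> f"
    using max(1)[of P] max(2)[of Q] max(3)[of P'] max(4)[of Q'] V(4)
    by (simp add: inner_diff_left)
  then have "r * ((P - Q) \<bullet> e + (P' - Q') \<bullet> f) \<le> r * ((P0 - Q0) \<bullet> e + (P1 - Q1) \<bullet> f)"
    using r by simp
  also have "\<dots> \<le> 2 * measure lebesgue K"
    using VV V(3,4) by (intro square_widths_le_area_extremal[OF sq r K]) (auto intro: max)
  finally show ?thesis .
qed

section \<open>Angles that the width bounds leave open\<close>

text \<open>Here \<open>(- p, q)\<close> and \<open>(p', q')\<close> are the sides from the feet of the triangle to its apex, in coordinates in which the
  segment is horizontal. Eliminating \<open>p\<close> and \<open>p'\<close> leaves \<open>q\<^sup>2 + q'\<^sup>2 - q * q' = 3/16\<close>. The quadratic form increases in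
  both variables where neither of them is more than twice the other, so an upper bound for one height is
  a lower bound for the other.\<close>

lemma steep_edges:
  fixes p q p' q' :: real
  assumes f: "p\<^sup>2 + q\<^sup>2 = 1/4" "p'\<^sup>2 + q'\<^sup>2 = 1/4" "q * q' - p * p' = 1/8"
    and flat: "\<bar>q - q'\<bar> \<le> q" "\<bar>q - q'\<bar> \<le> q'"
    and h: "q \<le> 0.454996" "q' \<le> 0.454996"
  shows "q \<ge> 0.40703" "q' \<ge> 0.40703" "q \<le> 0.4085 \<Longrightarrow> q' \<ge> 0.4539"
proof -
  have "p\<^sup>2 = 1/4 - q\<^sup>2" "p'\<^sup>2 = 1/4 - q'\<^sup>2" using f(1,2) by simp_all
  then have "(p * p')\<^sup>2 = (1/4 - q\<^sup>2) * (1/4 - q'\<^sup>2)"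
    by (simp only: power_mult_distrib)
  moreover have "p * p' = q * q' - 1/8" using f(3) by simp
  ultimately have eq: "q\<^sup>2 + q'\<^sup>2 - q * q' = 3/16"
    by (simp add: power2_eq_square field_simps)
  have mono: "x\<^sup>2 + y\<^sup>2 - x * y \<le> x'\<^sup>2 + y'\<^sup>2 - x' * y'"
    if "x \<le> x'" "y \<le> y'" "y \<le> 2 * x" "x' \<le> y'" "0 \<le> y" for x y x' y' :: real
  proof -
    have "x'\<^sup>2 + y'\<^sup>2 - x' * y' - (x\<^sup>2 + y\<^sup>2 - x * y)
       = (x' - x) * (x' + x - y) + (y' - y) * (y' + y - x')"
      by (simp add: power2_eq_square algebra_simps)
    moreover have "(x' - x) * (x' + x - y) \<ge> 0" using that by (intro mult_nonneg_nonneg) auto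
    moreover have "(y' - y) * (y' + y - x') \<ge> 0" using that by (intro mult_nonneg_nonneg) auto
    ultimately show ?thesis by linarith
  qed
  show "q \<ge> 0.40703"
  proof (rule ccontr)
    assume "\<not> q \<ge> 0.40703"
    then have "q\<^sup>2 + q'\<^sup>2 - q * q' \<le> 0.40703\<^sup>2 + 0.454996\<^sup>2 - 0.40703 * 0.454996"
      using flat h by (intro mono) auto
    then show False using eq by (simp add: power2_eq_square)
  qed
  show "q' \<ge> 0.40703"
  proof (rule ccontr)
    assume "\<not> q' \<ge> 0.40703"
    then have "q'\<^sup>2 + q\<^sup>2 - q' * q \<le> 0.40703\<^sup>2 + 0.454996\<^sup>2 - 0.40703 * 0.454996"
      using flat h by (intro mono) auto
    then show False using eq by (simp add: power2_eq_square mult.commute)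
  qed
  show "q' \<ge> 0.4539" if "q \<le> 0.4085"
  proof (rule ccontr)
    assume "\<not> q' \<ge> 0.4539"
    then have "q\<^sup>2 + q'\<^sup>2 - q * q' \<le> 0.4085\<^sup>2 + 0.4539\<^sup>2 - 0.4085 * 0.4539"
      using flat that by (intro mono) auto
    then show False using eq by (simp add: power2_eq_square)
  qed
qed

text \<open>The left-hand side \<open>c * (1 + q) + s * p\<close> of the mixed width bound is concave along the arc of admissible
  \<open>(c, s)\<close>. So it is estimated from below by replacing the arc by its chord, and likewise
  the arc \<open>p\<^sup>2 + q\<^sup>2 = 1/4\<close> by chords; the resulting linear inequalities hold at the end points. The value of
  the bound exceeds \<open>3 * 0.454996\<close> by less than 0.0003 in the worst case outside the corner, which dictates the
  precision of the constants.\<close>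

lemma tilt_bounds:
  fixes c s p q :: real
  assumes u: "c\<^sup>2 + s\<^sup>2 = 1" "0 \<le> s" "s \<le> c" and f: "p\<^sup>2 + q\<^sup>2 = 1/4" "0 \<le> p"
    and q: "0.40703 \<le> q" "q \<le> 0.454996"
    and height: "c + s \<le> 3 * 0.454996"
  shows "s \<le> 0.4977" "s \<ge> 0.497 \<Longrightarrow> 0.8673 \<le> c \<and> c \<le> 0.86776 \<and> c + s \<ge> 3 * 0.454916"
    and "c * (1 + q) + s * p < 3 * 0.454996 \<Longrightarrow> q \<le> 0.4085 \<and> s \<ge> 0.497"
    and "q \<le> 0.4085 \<Longrightarrow> 0.2883 \<le> p \<and> p \<le> 0.2904"
    and "q \<le> 0.4085 \<Longrightarrow> c * (1 + q) + s * p \<ge> 1.3648"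
proof -
  have c0: "0 \<le> c" using u by simp
  have c2: "c\<^sup>2 = 1 - s\<^sup>2" and p2: "p\<^sup>2 = 1/4 - q\<^sup>2" using u f by simp_all
  show s: "s \<le> 0.4977"
  proof (rule ccontr)
    assume "\<not> s \<le> 0.4977"
    then have s: "s > 0.4977" by simp
    have "c\<^sup>2 \<le> (3 * 0.454996 - s)\<^sup>2" using height c0 by (intro power_mono) auto
    moreover have "(s - 0.4977) * (s - 0.6825) \<le> 0"
      using s u(3) height by (intro mult_nonneg_nonpos) auto
    moreover have "(s - 0.4977) * (s - 0.6825) = s\<^sup>2 - 1.1802 * s + 0.33968025"
      "(3 * 0.454996 - s)\<^sup>2 = s\<^sup>2 - 2.729976 * s + 1.863192240144"
      by (simp_all add: power2_eq_square field_simps)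
    ultimately show False using s c2 by simp
  qed
  show "0.8673 \<le> c \<and> c \<le> 0.86776 \<and> c + s \<ge> 3 * 0.454916" if s': "s \<ge> 0.497"
  proof (intro conjI)
    have "s\<^sup>2 \<le> 0.4977\<^sup>2" "0.497\<^sup>2 \<le> s\<^sup>2" using s s' by (auto intro!: power_mono)
    then have "0.8673\<^sup>2 \<le> c\<^sup>2" "c\<^sup>2 \<le> 0.86776\<^sup>2" using c2 by (simp_all add: power2_eq_square)
    then show "0.8673 \<le> c" "c \<le> 0.86776" using c0 by (auto intro: power2_le_imp_le)
    have "(s - 0.497) * (s - 0.4977) \<le> 0" using s s' by (intro mult_nonneg_nonpos) auto
    moreover have "(s - 0.497) * (s - 0.4977) = s\<^sup>2 - 0.9947 * s + 0.2473569"
      "(3 * 0.454916 - s)\<^sup>2 = s\<^sup>2 - 2.729496 * s + 1.862537103504"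
      by (simp_all add: power2_eq_square field_simps)
    ultimately have "(3 * 0.454916 - s)\<^sup>2 \<le> c\<^sup>2" using c2 s' by simp
    then have "3 * 0.454916 - s \<le> c" using c0 by (auto intro: power2_le_imp_le)
    then show "c + s \<ge> 3 * 0.454916" by simp
  qed
  \<comment> \<open>The chord of the unit circle from \<open>s = 0\<close> to \<open>s = 2 * \<kappa> / (1 + \<kappa>\<^sup>2)\<close>.\<close>
  have chord: "c \<ge> 1 - \<kappa> * s" if "s * (1 + \<kappa>\<^sup>2) \<le> 2 * \<kappa>" for \<kappa>
  proof -
    have "s * (2 * \<kappa> - s * (1 + \<kappa>\<^sup>2)) \<ge> 0" using that u(2) by simp
    then have "(1 - \<kappa> * s)\<^sup>2 \<le> c\<^sup>2" using c2 by (simp add: power2_eq_square algebra_simps)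
    then show ?thesis using c0 by (auto intro: power2_le_imp_le)
  qed
  have lower: "c * (1 + q) + s * p \<ge> (1 + q) - \<sigma> * (\<kappa> * (1 + q) - l)"
    if "\<sigma> * (1 + \<kappa>\<^sup>2) \<le> 2 * \<kappa>" "s \<le> \<sigma>" "l \<le> p" "l \<le> \<kappa> * (1 + q)" for \<sigma> \<kappa> l
  proof -
    have "s * (1 + \<kappa>\<^sup>2) \<le> \<sigma> * (1 + \<kappa>\<^sup>2)" using that(2) by (intro mult_right_mono) auto
    then have "c \<ge> 1 - \<kappa> * s" using that(1) by (intro chord) simp
    then have "c * (1 + q) \<ge> (1 - \<kappa> * s) * (1 + q)" using q by (intro mult_right_mono) auto
    moreover have "s * p \<ge> s * l" using u(2) that by (intro mult_left_mono) auto
    moreover have "s * (\<kappa> * (1 + q) - l) \<le> \<sigma> * (\<kappa> * (1 + q) - l)"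
      using that by (intro mult_right_mono) auto
    ultimately show ?thesis by (simp add: algebra_simps)
  qed
  \<comment> \<open>A line just below the chord of the circle \<open>p\<^sup>2 + q\<^sup>2 = 1/4\<close> between \<open>q = 0.4085\<close> and \<open>q = 0.454996\<close>.\<close>
  have p_high: "p \<ge> 0.2883 - 1.743 * (q - 0.4085)" if "q \<ge> 0.4085"
  proof -
    have "(q - 0.4085) * (q - 0.454996) \<le> 0" using q that by (intro mult_nonneg_nonpos) auto
    moreover have "(q - 0.4085) * (q - 0.454996) = q\<^sup>2 - 0.863496 * q + 0.1858658660"
      "(0.2883 - 1.743 * (q - 0.4085))\<^sup>2 = 3.038049 * q\<^sup>2 - 3.4870998330 * q + 1.00063109954025"
      by (simp_all add: power2_eq_square field_simps)
    ultimately have "(0.2883 - 1.743 * (q - 0.4085))\<^sup>2 \<le> p\<^sup>2"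
      using p2 q that by simp
    then show ?thesis using f(2) by (auto intro: power2_le_imp_le)
  qed
  \<comment> \<open>The same for the chord between \<open>q = 0.40703\<close> and \<open>q = 0.4085\<close>.\<close>
  have p_low: "p \<ge> 0.2883 + 1.4 * (0.4085 - q)" if "q \<le> 0.4085"
  proof -
    have "(q - 0.40703) * (q - 0.4085) \<le> 0" using q that by (intro mult_nonneg_nonpos) auto
    moreover have "(q - 0.40703) * (q - 0.4085) = q\<^sup>2 - 0.81553 * q + 0.166271755"
      "(0.2883 + 1.4 * (0.4085 - q))\<^sup>2 = 1.96 * q\<^sup>2 - 2.408560 * q + 0.7399440400"
      by (simp_all add: power2_eq_square field_simps)
    ultimately have "(0.2883 + 1.4 * (0.4085 - q))\<^sup>2 \<le> p\<^sup>2"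
      using p2 q that by simp
    then show ?thesis using f(2) by (auto intro: power2_le_imp_le)
  qed
  show "q \<le> 0.4085 \<and> s \<ge> 0.497" if small: "c * (1 + q) + s * p < 3 * 0.454996"
  proof -
    have q': "q \<le> 0.4085"
    proof (rule ccontr)
      assume "\<not> q \<le> 0.4085"
      then have q': "q > 0.4085" by simp
      have "c * (1 + q) + s * p \<ge> (1 + q) - 0.4977 * (0.26653 * (1 + q) - (0.2883 - 1.743 * (q - 0.4085)))"
        using p_high s q q' by (intro lower) (simp_all add: power2_eq_square field_simps)
      moreover have "(1 + q) - 0.4977 * (0.26653 * (1 + q) - (0.2883 - 1.743 * (q - 0.4085))) \<ge> 3 * 0.454996"
        using q q' by (simp add: field_simps)
      ultimately show False using small by (meson not_less order_trans)
    qed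
    moreover have "s \<ge> 0.497"
    proof (rule ccontr)
      assume "\<not> s \<ge> 0.497"
      then have s': "s < 0.497" by simp
      have "c * (1 + q) + s * p \<ge> (1 + q) - 0.497 * (0.2661 * (1 + q) - (0.2883 + 1.4 * (0.4085 - q)))"
        using p_low[OF q'] s' q q' by (intro lower) (simp_all add: power2_eq_square field_simps)
      moreover have "(1 + q) - 0.497 * (0.2661 * (1 + q) - (0.2883 + 1.4 * (0.4085 - q))) \<ge> 3 * 0.454996"
        using q q' by (simp add: field_simps)
      ultimately show False using small by (meson not_less order_trans)
    qed
    ultimately show ?thesis by simp
  qed
  show "0.2883 \<le> p \<and> p \<le> 0.2904" if q': "q \<le> 0.4085"
  proof
    show "0.2883 \<le> p" using p_low[OF q'] q' by (simp add: field_simps)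
    have "0.40703\<^sup>2 \<le> q\<^sup>2" using q by (intro power_mono) auto
    then have "p\<^sup>2 \<le> 0.2904\<^sup>2" using p2 by (simp add: power2_eq_square)
    then show "p \<le> 0.2904" by (rule power2_le_imp_le) simp
  qed
  show "c * (1 + q) + s * p \<ge> 1.3648" if q': "q \<le> 0.4085"
  proof -
    have "c * (1 + q) + s * p \<ge> (1 + q) - 0.4977 * (0.26653 * (1 + q) - (0.2883 + 1.4 * (0.4085 - q)))"
      using p_low[OF q'] s q q' by (intro lower) (simp_all add: power2_eq_square field_simps)
    moreover have "(1 + q) - 0.4977 * (0.26653 * (1 + q) - (0.2883 + 1.4 * (0.4085 - q))) \<ge> 1.3648"
      using q q' by (simp add: field_simps)
    ultimately show ?thesis by (rule order_trans[rotated])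
  qed
qed

section \<open>The corner case\<close>

text \<open>The segment runs from \<open>(0, 0)\<close> to \<open>(1, 0)\<close>. The triangle has the feet \<open>(\<tau>, v)\<close> and \<open>(\<tau> - p - p', v + q - q')\<close> and the
  apex \<open>(\<tau> - p, v + q)\<close>; the top of the square is \<open>(X, a)\<close> and its bottom \<open>(X - (c - s) / 3, a - (c + s) / 3)\<close>. The
  assumptions \<open>w1\<close> and \<open>w2\<close> are the width bound of the square, with the foot \<open>(\<tau>, v)\<close> replacing the end \<open>(1, 0)\<close>
  along \<open>e\<close>, and with \<open>(1, 0)\<close> replacing that foot along \<open>f\<close>. The assumptions \<open>h1\<close> to \<open>h6\<close> come from crossing segments:
  the first three are heights, and the other three only serve to bound the position of the triangle. The
  assumptions \<open>m1\<close> and \<open>m2\<close> are the fans with the flat piece at the bottom and at the top, respectively.\<close>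

lemma corner_impossible:
  fixes c s p q p' q' \<tau> v X a H :: real
  assumes H: "H = 0.454996"
    and q: "0.40703 \<le> q" "q \<le> 0.4085" "0.4539 \<le> q'" "q' \<le> H"
    and p: "0.2883 \<le> p" "p \<le> 0.2904" "0.2073 \<le> p'" "p' \<le> 0.2098"
    and cs: "0.497 \<le> s" "s \<le> 0.4977" "0.8673 \<le> c" "c \<le> 0.86776" "c + s \<ge> 3 * 0.454916" "c + s \<le> 3 * H"
      "c * (1 + q) + s * p \<ge> 1.3648"
    and w1: "c * \<tau> + s * v + (c * q + s * p) \<le> 3 * H"
    and w2: "c + (s * (1 - \<tau> + p) + c * (v + q)) \<le> 3 * H"
    and h1: "(v + q) - (a - (c + s) / 3) \<le> H" and h2: "a - (v + q - q') \<le> H"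
    and h3: "q' - q - v \<le> H" and h4: "q' * (1 - \<tau>) + p' * v \<le> H"
    and h5: "- v * (1 - \<tau> + p + p') + (q' - q - v) * \<tau> \<le> H" and h6: "\<tau> * q' - v * p' \<le> H"
    and m1: "a \<ge> 0 \<Longrightarrow> v + q - q' \<le> 0 \<Longrightarrow> a - (c + s) / 3 \<le> 0 \<Longrightarrow>
      - (a - (c + s) / 3) - ((X - (c - s) / 3) * (v + q - q') - (\<tau> - p - p') * (a - (c + s) / 3)) + a \<le> H"
    and m2: "v + q \<ge> 0 \<Longrightarrow> a \<ge> 0 \<Longrightarrow> v + q - q' \<le> 0 \<Longrightarrow>
      (v + q) + ((\<tau> - p) * a - X * (v + q)) - (v + q - q') \<le> H"
  shows False
proof (cases "v \<ge> 0.001")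
  case True
  \<comment> \<open>The foot \<open>(\<tau>, v)\<close> is farther along \<open>e\<close> than \<open>(1, 0)\<close> if \<open>\<tau> \<ge> 1\<close>, and farther along \<open>f\<close> otherwise.\<close>
  have sv: "s * v \<ge> 0.497 * 0.001" and cv: "c * v \<ge> 0.8673 * 0.001"
    using cs True by (intro mult_mono; simp)+
  have base: "c + c * q + s * p \<ge> 1.3648" using cs(7) by (simp add: algebra_simps)
  show False
  proof (cases "\<tau> \<ge> 1")
    case True
    then have "c * \<tau> \<ge> c * 1" using cs by (intro mult_left_mono) auto
    then show False using w1 base sv H by simp
  next
    case False
    then have "s * (1 - \<tau>) \<ge> 0" using cs by simp
    then show False using w2 base cv H by (simp add: algebra_simps)
  qed
next
  case False
  \<comment> \<open>The height \<open>e\<close> of the apex and the depth \<open>t\<close> of the lower foot; below, \<open>d\<close> is the depth of the square.\<close>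
  define e t x where "e = v + q" and "t = q' - e" and "x = \<tau> - p - p'"
  have t: "t \<ge> 0.0444" using False q by (simp add: t_def e_def)
  have hS: "(c + s) / 3 \<ge> 0.454916" "(c + s) / 3 \<le> 0.454996"
    using cs(5,6) H by simp_all
  define h where "h = (c + s) / 3"
  note hS = hS[folded h_def] and h1 = h1[folded h_def] and m1 = m1[folded h_def]
  \<comment> \<open>The heights of triangle and square nearly exhaust \<open>H\<close>, so their tops and their bottoms are level up to 0.0012.\<close>
  have ae: "a - e \<le> 0.0011" "e - a \<le> 0.00008"
    using h1 h2 q(3) hS H unfolding e_def by simp_all
  define d where "d = h - a"
  have td: "\<bar>t - d\<bar> \<le> 0.00118"
    unfolding t_def d_def by (rule abs_leI) (use ae q(3,4) hS H in simp_all)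
  \<comment> \<open>Rough bounds on the horizontal position, so that the level differences have little effect.\<close>
  have tau_lo: "\<tau> \<ge> - 0.2"
  proof (rule ccontr)
    assume "\<not> \<tau> \<ge> - 0.2"
    then have "q' * (1 - \<tau>) \<ge> 0.4539 * 1.2" using q by (intro mult_mono) auto
    moreover have "p' * (- v) \<le> 0.2098 * 0.41"
    proof (cases "v \<le> 0")
      case True
      then show ?thesis using p h3 q H by (intro mult_mono) auto
    next
      case False
      then have "p' * (-v) \<le> 0" using p by (simp add: mult_nonneg_nonneg)
      then show ?thesis by simp
    qed
    ultimately show False using h4 H by simp
  qed
  have tau_hi: "\<tau> \<le> 1.003"
  proof (rule ccontr)
    assume "\<not> \<tau> \<le> 1.003"
    then have "\<tau> * q' \<ge> 1.003 * 0.4539" using q by (intro mult_mono) auto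
    moreover have "v * p' \<le> 0.001 * p'"
      using False p by (intro mult_right_mono) auto
    ultimately show False using h6 p H by simp
  qed
  have e: "e \<ge> 0.09"
  proof (rule ccontr)
    assume e: "\<not> e \<ge> 0.09"
    then have v: "- v \<ge> 0.317" using q by (simp add: e_def)
    define A B where "A = - v * (1 + p + p')" and "B = (q' - q) * \<tau>"
    have "A + B \<le> H"
      using h5 by (simp add: A_def B_def algebra_simps)
    moreover have "A \<ge> 0.317 * 1.4956"
      unfolding A_def using v p by (intro mult_mono) auto
    moreover have "B \<ge> (q' - q) * (- 0.2)"
      unfolding B_def using q tau_lo by (intro mult_left_mono) auto
    moreover have "(q' - q) * (- 0.2) \<ge> - 0.0097" using q H by simp
    ultimately have "A + B \<le> H" "A \<ge> 0.317 * 1.4956" "B \<ge> - 0.0097"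
      by (blast intro: order_trans)+
    then show False using H by simp
  qed
  have a: "a \<ge> 0" using e ae by simp
  have d: "d \<ge> 0" using t td[THEN abs_le_D1] by simp
  have x: "\<bar>x\<bar> \<le> 0.75" unfolding x_def by (rule abs_leI) (use tau_lo tau_hi p in simp_all)
  \<comment> \<open>The horizontal offset of the tops; that of the bottoms is \<open>\<Delta> + p' - (c - s) / 3 > \<Delta> + 0.083\<close>.\<close>
  define \<Delta> where "\<Delta> = X - (\<tau> - p)"
  show False
  proof (cases "\<Delta> \<ge> - 0.04")
    case True
    have "- (- d) - ((X - (c - s) / 3) * (- t) - x * (- d)) + a \<le> H"
      using m1 a d t by (simp add: d_def t_def e_def x_def)
    moreover have "- (- d) - ((X - (c - s) / 3) * (- t) - x * (- d)) + a
       = h + t * (\<Delta> + p' - (c - s) / 3) + (t - d) * x"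
      by (simp add: \<Delta>_def x_def d_def field_simps)
    moreover have "\<Delta> + p' - (c - s) / 3 \<ge> 0.0437"
      using True p cs(1,4) by (simp add: field_simps)
    then have "t * (\<Delta> + p' - (c - s) / 3) \<ge> 0.0444 * 0.0437"
      using t by (intro mult_mono) auto
    moreover have "\<bar>(t - d) * x\<bar> \<le> 0.00118 * 0.75"
      unfolding abs_mult using td x by (intro mult_mono) auto
    ultimately show False using hS H by (simp add: abs_le_iff)
  next
    case False
    have "e + ((\<tau> - p) * a - X * e) + t \<le> H"
      using m2 a e t by (simp add: e_def t_def)
    moreover have "e + ((\<tau> - p) * a - X * e) + t = q' + (\<tau> - p) * (a - e) + (- \<Delta>) * e"
      by (simp add: \<Delta>_def t_def algebra_simps)
    moreover have "(- \<Delta>) * e \<ge> 0.04 * 0.09" using False e by (intro mult_mono) auto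
    moreover have "\<bar>\<tau> - p\<bar> \<le> 0.8" "\<bar>a - e\<bar> \<le> 0.0011"
      by (rule abs_leI; use ae tau_lo tau_hi p in simp)+
    then have "\<bar>(\<tau> - p) * (a - e)\<bar> \<le> 0.8 * 0.0011"
      unfolding abs_mult by (intro mult_mono) auto
    ultimately show False using q H by (simp add: abs_le_iff)
  qed
qed

section \<open>Normal position\<close>

text \<open>The passage from vectors to the numerical lemmas: \<open>tilt_bounds\<close> reduces the angles to the corner, and
  \<open>corner_impossible\<close> excludes it. The vertex \<open>w\<close> is the lowest one of the square and \<open>St\<close> the highest.\<close>

lemma area_in_normal_position:
  assumes ln: "orthonormal l n" and K: "convex K" "K \<in> lmeasurable"
    and seg: "z \<in> K" "z + l \<in> K"
    and tri: "Tl \<in> K" "Tr \<in> K" "Tt \<in> K"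
    and dist: "dist Tt Tr = 1/2" "dist Tt Tl = 1/2" "dist Tr Tl = 1/2"
    and f: "(Tt - Tr) \<bullet> l = - p" "(Tt - Tr) \<bullet> n = q" "p \<ge> 0"
    and g: "(Tt - Tl) \<bullet> l = p'" "(Tt - Tl) \<bullet> n = q'" "p' \<ge> 0"
    and flat: "\<bar>q - q'\<bar> \<le> q" "\<bar>q - q'\<bar> \<le> q'"
    and sq: "square_in K (1/3) w e1 e2"
    and e1: "e1 \<bullet> l = c" "e1 \<bullet> n = s" and e2: "e2 \<bullet> l = - s" "e2 \<bullet> n = c"
    and sc: "0 \<le> s" "s \<le> c"
  shows "measure lebesgue K \<ge> 0.227498"
proof (rule ccontr)
  define H :: real where "H = 0.454996"
  assume "\<not> measure lebesgue K \<ge> 0.227498"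
  then have small: "2 * measure lebesgue K < H" by (simp add: H_def)
  note ips = orthonormal_inner[OF ln]
  have onb: "l \<bullet> l = 1" "n \<bullet> n = 1" "l \<bullet> n = 0" "n \<bullet> l = 0"
    using ln by (auto simp: orthonormal_def inner_commute)
  have sqK: "w \<in> K" "w + (1/3) *\<^sub>R e1 + (1/3) *\<^sub>R e2 \<in> K" and e: "orthonormal e1 e2"
    using sq by (auto simp: square_in_def)
  have wid: "cross l n (B - A) (P - Q) < H"
    if "A \<in> K" "B \<in> K" "P \<in> K" "Q \<in> K" for A B P Q
    using crossing_segments_le_area[OF ln K that] small by simp
  have height: "(P - Q) \<bullet> n \<le> H" if "P \<in> K" "Q \<in> K" for P Q
    using wid[OF seg that] onb by (simp add: cross_def)
  have mixed: "(P - Q) \<bullet> e1 + (P' - Q') \<bullet> e2 < 3 * H"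
    if "P \<in> K" "Q \<in> K" "P' \<in> K" "Q' \<in> K" for P Q P' Q'
    using square_widths_le_area[OF sq _ K that] small by simp
  have cs: "c\<^sup>2 + s\<^sup>2 = 1"
    using e ips[of e1 e1] e1 by (simp add: orthonormal_def power2_eq_square)
  define St where "St = w + (1/3) *\<^sub>R e1 + (1/3) *\<^sub>R e2"
  have St: "St \<in> K" "(St - w) \<bullet> l = (c - s) / 3" "(St - w) \<bullet> n = (c + s) / 3"
    using sqK e1 e2 by (auto simp: St_def inner_add_left)
  have len: "p\<^sup>2 + q\<^sup>2 = 1/4" "p'\<^sup>2 + q'\<^sup>2 = 1/4"
    using dist(1,2)[THEN inner_diff_self_eq_dist] unfolding ips[of "Tt - Tr" "Tt - Tr"] ips[of "Tt - Tl" "Tt - Tl"] f g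
    by (simp_all add: power2_eq_square)
  have "(Tr - Tl) \<bullet> l = p' + p" "(Tr - Tl) \<bullet> n = q' - q"
    using f g by (simp_all add: inner_diff_left)
  then have "(p' + p)\<^sup>2 + (q' - q)\<^sup>2 = 1/4"
    using inner_diff_self_eq_dist[OF dist(3)] ips[of "Tr - Tl" "Tr - Tl"] by (simp add: power2_eq_square)
  then have angle: "q * q' - p * p' = 1/8"
    using len by (simp add: power2_eq_square algebra_simps)
  have h: "c + s \<le> 3 * 0.454996" "q \<le> 0.454996" "q' \<le> 0.454996"
    using height[OF St(1) sqK(1)] height[OF tri(3) tri(2)] height[OF tri(3) tri(1)] St f g
    by (simp_all add: H_def)
  note steep = steep_edges[OF len angle flat h(2,3)]
  note mb = tilt_bounds[OF cs sc len(1) f(3) steep(1) h(2,1)]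
  have f2: "(Tt - Tr) \<bullet> e2 = c * q + s * p"
    using ips[of "Tt - Tr" e2] f e2 by simp
  have le: "l \<bullet> e1 = c" "l \<bullet> e2 = - s"
    using e1 e2 by (simp_all add: inner_commute)
  have "c * (1 + q) + s * p < 3 * 0.454996"
    using mixed[OF seg(2,1) tri(3,2)] f2 le by (simp add: H_def algebra_simps)
  then have q: "q \<le> 0.4085" and s: "s \<ge> 0.497" using mb(3) by auto
  have "0.4539\<^sup>2 \<le> q'\<^sup>2" "q'\<^sup>2 \<le> 0.454996\<^sup>2"
    using steep(3)[OF q] h(3) by (auto intro!: power_mono)
  then have "0.2073\<^sup>2 \<le> p'\<^sup>2" "p'\<^sup>2 \<le> 0.2098\<^sup>2"
    using len(2) by (simp_all add: power2_eq_square)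
  then have p': "0.2073 \<le> p'" "p' \<le> 0.2098"
    using g(3) by (auto intro: power2_le_imp_le)
  define \<tau> v X a where "\<tau> = (Tr - z) \<bullet> l" and "v = (Tr - z) \<bullet> n"
    and "X = (St - z) \<bullet> l" and "a = (St - z) \<bullet> n"
  have co: "(Tr - z) \<bullet> l = \<tau>" "(Tr - z) \<bullet> n = v" "(Tt - z) \<bullet> l = \<tau> - p" "(Tt - z) \<bullet> n = v + q"
    "(Tl - z) \<bullet> l = \<tau> - p - p'" "(Tl - z) \<bullet> n = v + q - q'"
    "(St - z) \<bullet> l = X" "(St - z) \<bullet> n = a"
    "(w - z) \<bullet> l = X - (c - s) / 3" "(w - z) \<bullet> n = a - (c + s) / 3"
    using f g St by (simp_all add: \<tau>_def v_def X_def a_def inner_diff_left field_simps)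
  note expand = co[unfolded inner_diff_left, unfolded diff_eq_eq]
  show False
  proof (rule corner_impossible[of H q q' p p' s c \<tau> v a X])
    show "c * \<tau> + s * v + (c * q + s * p) \<le> 3 * H"
      using mixed[OF tri(2) seg(1) tri(3,2)] f2 ips[of "Tr - z" e1] co e1 by (simp add: algebra_simps)
    show "c + (s * (1 - \<tau> + p) + c * (v + q)) \<le> 3 * H"
    proof -
      have "(Tt - z) \<bullet> e2 = (\<tau> - p) * (- s) + (v + q) * c"
        using ips[of "Tt - z" e2] co e2 by simp
      moreover have "Tt - (z + l) = (Tt - z) - l" by simp
      ultimately have "(Tt - (z + l)) \<bullet> e2 = s * (1 - \<tau> + p) + c * (v + q)"
        using le by (simp only: inner_diff_left) (simp add: algebra_simps)
      then show ?thesis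
        using mixed[OF seg(2,1) tri(3) seg(2)] le by simp
    qed
    show "v + q - (a - (c + s) / 3) \<le> H"
      using height[OF tri(3) sqK(1)] expand by (simp add: inner_diff_left)
    show "a - (v + q - q') \<le> H"
      using height[OF St(1) tri(1)] expand by (simp add: inner_diff_left)
    show "q' - q - v \<le> H"
      using height[OF seg(1) tri(1)] expand by (simp add: inner_diff_left)
    show "q' * (1 - \<tau>) + p' * v \<le> H"
    proof -
      have "(Tr - (z + l)) \<bullet> l = \<tau> - 1" "(Tr - (z + l)) \<bullet> n = v"
        using co(1,2) onb by (simp_all add: inner_diff_left inner_add_left)
      then have "p' * v - q' * (\<tau> - 1) < H"
        using wid[OF tri(1,3,2) seg(2)] g by (simp only: cross_def)
      then show ?thesis by (simp add: algebra_simps)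
    qed
    show "- v * (1 - \<tau> + p + p') + (q' - q - v) * \<tau> \<le> H"
      using wid[OF tri(1) seg(2,1) tri(2)] expand onb
      by (simp add: cross_def inner_diff_left inner_add_left algebra_simps)
    show "\<tau> * q' - v * p' \<le> H"
      using wid[OF seg(1) tri(2,3,1)] g co by (simp add: cross_def)
    show "- (a - (c + s) / 3) - ((X - (c - s) / 3) * (v + q - q')
        - (\<tau> - p - p') * (a - (c + s) / 3)) + a \<le> H"
      if "a \<ge> 0" "v + q - q' \<le> 0" "a - (c + s) / 3 \<le> 0"
    proof -
      have "- (a - (c + s) / 3) \<ge> 0" "- (v + q - q') \<ge> 0" "- a \<le> 0" using that by auto
      note fan = fan_le_area[OF orthonormal_minus(2)[OF ln] K seg sqK(1) tri(1) St(1),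
          unfolded cross_def inner_minus_right co, OF this]
      have "- y1 - (x1 * y2 - x2 * y1) + y3 = - y1 + (x1 * - y2 - - y1 * x2) - - y3"
        for x1 y1 x2 y2 y3 :: real
        by (simp add: algebra_simps)
      then show ?thesis
        using fan small by (simp only:)
    qed
    show "v + q + ((\<tau> - p) * a - X * (v + q)) - (v + q - q') \<le> H"
      if "v + q \<ge> 0" "a \<ge> 0" "v + q - q' \<le> 0"
      using fan_le_area[OF ln K seg tri(3) St(1) tri(1), unfolded cross_def co, OF that] small
      by (simp add: mult.commute)
  qed (use steep q h mb(1) mb(2)[OF s] mb(4,5)[OF q] p' s in \<open>auto simp: H_def\<close>)
qed

text \<open>The apex \<open>A\<close> is opposite to the flattest side, and the normal is reversed if the apex is below that side.\<close>

lemma triangle_normal_position: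
  fixes x y z n0 :: "real^2"
  obtains n A B C where "n = n0 \<or> n = - n0" "{A, B, C} = {x, y, z}"
    "\<bar>(A - B) \<bullet> n - (A - C) \<bullet> n\<bar> \<le> (A - B) \<bullet> n" "\<bar>(A - B) \<bullet> n - (A - C) \<bullet> n\<bar> \<le> (A - C) \<bullet> n"
proof -
  note result = that
  have sorted: thesis
    if ord: "P \<bullet> n0 \<le> Q \<bullet> n0" "Q \<bullet> n0 \<le> R \<bullet> n0" and eq: "{P, Q, R} = {x, y, z}" for P Q R
  proof (cases "Q \<bullet> n0 - P \<bullet> n0 \<le> R \<bullet> n0 - Q \<bullet> n0")
    case True
    then show thesis
      using ord eq by (intro result[of n0 R Q P]) (auto simp: inner_diff_left)
  next
    case False
    then show thesis
      using ord eq by (intro result[of "- n0" P Q R]) (auto simp: inner_diff_left)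
  qed
  consider "x \<bullet> n0 \<le> y \<bullet> n0" "y \<bullet> n0 \<le> z \<bullet> n0" | "x \<bullet> n0 \<le> z \<bullet> n0" "z \<bullet> n0 \<le> y \<bullet> n0"
    | "y \<bullet> n0 \<le> x \<bullet> n0" "x \<bullet> n0 \<le> z \<bullet> n0" | "y \<bullet> n0 \<le> z \<bullet> n0" "z \<bullet> n0 \<le> x \<bullet> n0"
    | "z \<bullet> n0 \<le> x \<bullet> n0" "x \<bullet> n0 \<le> y \<bullet> n0" | "z \<bullet> n0 \<le> y \<bullet> n0" "y \<bullet> n0 \<le> x \<bullet> n0"
    by linarith
  then show thesis
    using sorted[of x y z] sorted[of x z y] sorted[of y x z] sorted[of y z x] sorted[of z x y]
      sorted[of z y x] by cases (simp_all add: insert_commute)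
qed

lemma square_in_swap: "square_in K r w e f \<Longrightarrow> square_in K r w f e"
  by (auto simp: square_in_def orthonormal_minus(3) add_ac)

lemma square_in_flip: "square_in K r w e f \<Longrightarrow> square_in K r (w + r *\<^sub>R e) (- e) f"
  by (auto simp: square_in_def orthonormal_minus(1) add_ac)

lemma square_in_flip': "square_in K r w e f \<Longrightarrow> square_in K r (w + r *\<^sub>R f) e (- f)"
  using square_in_swap square_in_flip by blast

text \<open>A square of tilt between 0 and 45 degrees: exchanging the axes makes the first one the flatter one, and reversing the
  axes of the square and then the horizontal axis fixes the signs. The vertical axis \<open>n\<close> is kept, since the
  triangle has already determined it.\<close>

lemma square_normal_position:
  assumes ln: "orthonormal l0 n" and sq: "square_in K r w0 e0 f0"
  obtains l w e f c s where "l = l0 \<or> l = - l0" "square_in K r w e f"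
    "e \<bullet> l = c" "e \<bullet> n = s" "f \<bullet> l = - s" "f \<bullet> n = c" "0 \<le> s" "s \<le> c"
proof -
  note ips = orthonormal_inner[OF ln]
  have coords: "f \<bullet> l0 = - (e \<bullet> n) \<and> f \<bullet> n = e \<bullet> l0 \<or> f \<bullet> l0 = e \<bullet> n \<and> f \<bullet> n = - (e \<bullet> l0)"
    if "square_in K r w e f" for w e f
  proof -
    have on: "e \<bullet> e = 1" "f \<bullet> f = 1" "e \<bullet> f = 0"
      using that by (auto simp: square_in_def orthonormal_def)
    define \<alpha> \<beta> \<gamma> \<delta> where "\<alpha> = e \<bullet> l0" and "\<beta> = e \<bullet> n" and "\<gamma> = f \<bullet> l0" and "\<delta> = f \<bullet> n"
    have eqs: "\<alpha> * \<alpha> + \<beta> * \<beta> = 1" "\<gamma> * \<gamma> + \<delta> * \<delta> = 1" "\<alpha> * \<gamma> + \<beta> * \<delta> = 0"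
      using on ips[of e e] ips[of f f] ips[of e f]
      by (simp_all add: \<alpha>_def \<beta>_def \<gamma>_def \<delta>_def)
    define t where "t = \<alpha> * \<delta> - \<beta> * \<gamma>"
    have "\<gamma> = - t * \<beta>" "\<delta> = t * \<alpha>"
      unfolding t_def using eqs(1,3) by algebra+
    moreover have "t\<^sup>2 = 1"
      using calculation eqs by algebra
    ultimately show ?thesis
      by (auto simp: power2_eq_1_iff \<alpha>_def \<beta>_def \<gamma>_def \<delta>_def)
  qed
  obtain w1 e1 f1 where 1: "square_in K r w1 e1 f1" "\<bar>e1 \<bullet> n\<bar> \<le> \<bar>e1 \<bullet> l0\<bar>"
  proof (cases "\<bar>e0 \<bullet> n\<bar> \<le> \<bar>e0 \<bullet> l0\<bar>")
    case False
    then have "\<bar>f0 \<bullet> n\<bar> \<le> \<bar>f0 \<bullet> l0\<bar>" using coords[OF sq] by auto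
    then show thesis using that square_in_swap[OF sq] by blast
  qed (use sq that in blast)
  obtain w2 e2 where 2: "square_in K r w2 e2 f1" "\<bar>e2 \<bullet> n\<bar> \<le> e2 \<bullet> l0"
  proof (cases "e1 \<bullet> l0 \<ge> 0")
    case False
    then show thesis using that[of _ "- e1"] square_in_flip[OF 1(1)] 1(2) by auto
  qed (use 1 that in auto)
  obtain w f where 3: "square_in K r w e2 f" "f \<bullet> l0 = - (e2 \<bullet> n)" "f \<bullet> n = e2 \<bullet> l0"
    using coords[OF 2(1)]
  proof
    assume "f1 \<bullet> l0 = e2 \<bullet> n \<and> f1 \<bullet> n = - (e2 \<bullet> l0)"
    then show thesis using that[of _ "- f1"] square_in_flip'[OF 2(1)] by auto
  qed (use 2 that in auto)
  show thesis
  proof (cases "e2 \<bullet> n \<ge> 0")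
    case True
    then show thesis using that[of l0 w e2 f] 2 3 by auto
  next
    case False
    then show thesis using that[of "- l0" _ "- e2" f] square_in_flip[OF 3(1)] 2 3 by auto
  qed
qed

theorem theorem1:
  fixes L T S :: "(real^2) set"
  assumes "segment_of_length 1 L"
    and "equilateral_triangle (1/2) T"
    and "square (1/3) S"
  shows "measure lebesgue (convex hull (L \<union> T \<union> S)) \<ge> 0.227498"
proof -
  define K where "K = convex hull (L \<union> T \<union> S)"
  obtain a b where L: "dist a b = 1" "L = closed_segment a b"
    using assms(1) by (auto simp: segment_of_length_def)
  obtain x y z where T: "dist x y = 1/2" "dist y z = 1/2" "dist z x = 1/2" "T = convex hull {x, y, z}"
    using assms(2) by (auto simp: equilateral_triangle_def)
  obtain w u v w' where S: "w' - v = u - w" "orthogonal (u - w) (v - w)" "dist w u = 1/3" "dist w v = 1/3"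
    "S = convex hull {w, u, w', v}"
    using assms(3) by (auto simp: square_def)
  have "compact L" "compact T" "compact S"
    by (simp_all add: L T S finite_imp_compact_convex_hull)
  then have "compact K"
    unfolding K_def by (intro compact_convex_hull compact_Un)
  then have K: "convex K" "K \<in> lmeasurable"
    by (simp_all add: K_def lmeasurable_compact)
  have sub: "{a, b} \<subseteq> K" "{x, y, z} \<subseteq> K" "{w, u, v, w'} \<subseteq> K"
    using hull_subset[of "L \<union> T \<union> S" convex] hull_subset[of "{x, y, z}" convex]
      hull_subset[of "{w, u, w', v}" convex]
    by (auto simp: K_def L T S)

  define l0 where "l0 = b - a"
  define n0 :: "real^2" where "n0 = vector [- l0$2, l0$1]"
  have "l0 \<bullet> l0 = 1"
    using L(1) by (simp add: l0_def dot_square_norm dist_norm norm_minus_commute)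
  then have on0: "orthonormal l0 n0"
    by (simp add: orthonormal_def inner2 n0_def algebra_simps)

  have sq0: "square_in K (1/3) w (3 *\<^sub>R (u - w)) (3 *\<^sub>R (v - w))"
  proof -
    have "(u - w) \<bullet> (u - w) = 1/9" "(v - w) \<bullet> (v - w) = 1/9"
      using S(3,4) by (simp_all only: dot_square_norm dist_norm norm_minus_commute)
        (simp_all add: power_divide)
    moreover have "w' = u + v - w" using S(1) by (simp add: algebra_simps)
    ultimately show ?thesis
      using S(2) sub(3) by (simp add: square_in_def orthonormal_def orthogonal_def add_diff_eq)
  qed

  obtain n A B C where n: "n = n0 \<or> n = - n0" and ABC: "{A, B, C} = {x, y, z}"
    and flat: "\<bar>(A - B) \<bullet> n - (A - C) \<bullet> n\<bar> \<le> (A - B) \<bullet> n" "\<bar>(A - B) \<bullet> n - (A - C) \<bullet> n\<bar> \<le> (A - C) \<bullet> n"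
    by (rule triangle_normal_position[of n0 x y z])
  have "orthonormal l0 n"
    using n on0 orthonormal_minus(2) by blast
  then obtain l w1 e f c s where l: "l = l0 \<or> l = - l0" and sq: "square_in K (1/3) w1 e f"
    and ef: "e \<bullet> l = c" "e \<bullet> n = s" "f \<bullet> l = - s" "f \<bullet> n = c" "0 \<le> s" "s \<le> c"
    using square_normal_position[OF _ sq0] by metis
  have ln: "orthonormal l n"
    using l \<open>orthonormal l0 n\<close> orthonormal_minus(1) by blast
  obtain o' where seg: "o' \<in> K" "o' + l \<in> K"
    using l sub(1) by (auto simp: l0_def intro: that[of a] that[of b])
  have mem: "A \<in> K" "B \<in> K" "C \<in> K"
    using ABC sub(2) by auto
  have dists: "dist A B = 1/2" "dist A C = 1/2" "dist B C = 1/2"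
  proof -
    have "card {A, B, C} = 3"
      unfolding ABC using T by (auto simp: card_insert_if)
    then have "A \<noteq> B" "A \<noteq> C" "B \<noteq> C"
      by (auto simp: card_insert_if split: if_splits)
    moreover have "dist P Q = 1/2" if "P \<in> {x, y, z}" "Q \<in> {x, y, z}" "P \<noteq> Q" for P Q
      using that T by (auto simp: dist_commute)
    moreover have "A \<in> {x, y, z}" "B \<in> {x, y, z}" "C \<in> {x, y, z}"
      using ABC by auto
    ultimately show "dist A B = 1/2" "dist A C = 1/2" "dist B C = 1/2"
      by blast+
  qed
  define \<alpha> \<beta> q q' where "\<alpha> = (A - B) \<bullet> l" and "\<beta> = (A - C) \<bullet> l"
    and "q = (A - B) \<bullet> n" and "q' = (A - C) \<bullet> n"
  note co = \<alpha>_def[symmetric] \<beta>_def[symmetric] q_def[symmetric] q'_def[symmetric]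
  note flat = flat[unfolded co]
  \<comment> \<open>The feet lie on different sides of the vertical line through the apex, because the side \<open>BC\<close> is the flattest.\<close>
  have "\<alpha> * \<beta> \<le> 0"
  proof -
    have "(B - C) \<bullet> l = \<beta> - \<alpha>" "(B - C) \<bullet> n = q' - q"
      by (simp_all add: \<alpha>_def \<beta>_def q_def q'_def inner_diff_left)
    then have eqs: "\<alpha>\<^sup>2 + q\<^sup>2 = 1/4" "\<beta>\<^sup>2 + q'\<^sup>2 = 1/4" "(\<beta> - \<alpha>)\<^sup>2 + (q' - q)\<^sup>2 = 1/4"
      using dists[THEN inner_diff_self_eq_dist]
      unfolding orthonormal_inner[OF ln, of "A - B" "A - B"] orthonormal_inner[OF ln, of "A - C" "A - C"]
        orthonormal_inner[OF ln, of "B - C" "B - C"] co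
      by (simp_all add: power2_eq_square)
    then have ab: "\<alpha> * \<beta> = 1/8 - q * q'"
      by (simp add: power2_eq_square algebra_simps)
    have "\<alpha>\<^sup>2 = 1/4 - q\<^sup>2" "\<beta>\<^sup>2 = 1/4 - q'\<^sup>2" using eqs(1,2) by simp_all
    then have "(1/8 - q * q')\<^sup>2 = (1/4 - q\<^sup>2) * (1/4 - q'\<^sup>2)"
      by (simp only: ab[symmetric] power_mult_distrib)
    then have "q\<^sup>2 + q'\<^sup>2 - q * q' = 3/16"
      by (simp add: power2_eq_square field_simps)
    moreover have "(2 * q - q') * (2 * q' - q) \<ge> 0"
      using flat by (intro mult_nonneg_nonneg) auto
    ultimately have "q * q' \<ge> 1/8"
      by (simp add: power2_eq_square algebra_simps)
    then show ?thesis using ab by simp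
  qed
  then consider "\<alpha> \<le> 0" "\<beta> \<ge> 0" | "\<beta> \<le> 0" "\<alpha> \<ge> 0"
    by (auto simp: mult_le_0_iff)
  then have "measure lebesgue K \<ge> 0.227498"
  proof cases
    case 1
    then show ?thesis
      using area_in_normal_position[OF ln K seg mem(3,2,1) dists, of "- \<alpha>" q \<beta> q'] sq ef flat co
      by simp
  next
    case 2
    have "dist C B = 1/2" using dists(3) by (simp add: dist_commute)
    then show ?thesis
      using area_in_normal_position[OF ln K seg mem(2,3,1) dists(2,1), of "- \<beta>" q' \<alpha> q] sq ef flat co 2
      by (simp add: abs_minus_commute)
  qed
  then show ?thesis by (simp add: K_def)
qed

end
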